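(* Let $k\ge 1$ and let $a_2,\dots,a_n$ be nonnegative integers. Then $$\#\mathcal L_{k+2}(k+1,a_2,\dots,a_n)=\#\mathcal L_{k+2}(k,a_2,\dots,a_n),$$ and there is an explicit bijection between these sets.
   Context: For nonnegative integers $a_1,\dots,a_n$, an $(a_1,\dots,a_n)$-ascending permutation is a permutation $\pi$ of $\{1,2,\dots,a_1+\cdots+a_n\}$, written as a word, whose descent set is contained in $\{a_1,a_1+a_2,\dots,a_1+\cdots+a_{n-1}\}$; that is, when the word is cut into consecutive blocks of lengths $a_1,\dots,a_n$, it is increasing within each block. $\mathcal L_{k+2}(a_1,\dots,a_n)$ denotes the set of $(a_1,\dots,a_n)$-ascending permutations which avoid the pattern $12\dots(k+2)$, i.e. which have no increasing subsequence of length $k+2$. *)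

theory Defs
  imports "HOL-Combinatorics.Multiset_Permutations" "HOL-Library.Sublist"
begin

text \<open>
  Permutations of \<open>{1..N}\<close> are written as words, i.e. as elements of
  \<^term>\<open>permutations_of_set {1..N::nat}\<close>. The descent set is 1-based, as is usual,
  while list indexing is 0-based: \<open>i\<close> is a descent of \<open>w\<close> iff the \<open>i\<close>-th letter
  \<open>w ! (i - 1)\<close> exceeds the \<open>(i+1)\<close>-st letter \<open>w ! i\<close>.
\<close>

definition descent_set :: "nat list \<Rightarrow> nat set" where
  "descent_set w = {i. 1 \<le> i \<and> i < length w \<and> w ! (i - 1) > w ! i}"

definition partial_sums :: "nat list \<Rightarrow> nat set" where
  "partial_sums a = {sum_list (take j a) | j. 1 \<le> j \<and> j < length a}"

definition ascending_perms :: "nat list \<Rightarrow> nat list set" where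
  "ascending_perms a =
     {w \<in> permutations_of_set {1..sum_list a}. descent_set w \<subseteq> partial_sums a}"

definition avoids_increasing :: "nat \<Rightarrow> nat list \<Rightarrow> bool" where
  "avoids_increasing m w \<longleftrightarrow>
     \<not> (\<exists>v. subseq v w \<and> length v = m \<and> sorted_wrt (<) v)"

definition asc_avoiders :: "nat \<Rightarrow> nat list \<Rightarrow> nat list set" where
  "asc_avoiders m a = {w \<in> ascending_perms a. avoids_increasing m w}"

text \<open>
  Deleting the largest letter \<open>N\<close> from a permutation of \<open>{1..N}\<close> leaves a permutation of
  \<open>{1..N-1}\<close>, so no relabelling of the remaining letters is needed.
\<close>

definition delete_largest :: "nat list \<Rightarrow> nat list" where
  "delete_largest w = remove1 (Max (set w)) w"

end

theory Submission
  imports Defs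
begin

text \<open>
  If the first block has length \<open>k + 1\<close>, its last letter must be the largest letter \<open>N\<close>: otherwise
  \<open>N\<close> occurs later and extends the block to an increasing subsequence of length \<open>k + 2\<close>. Conversely,
  inserting \<open>N\<close> at the end of a first block of length \<open>k\<close> creates no increasing subsequence of
  length \<open>k + 2\<close>, because such a subsequence through \<open>N\<close> would have to end there.
\<close>

text \<open>Reindexing by \<open>j = Suc i\<close> makes visible that every allowed descent is at
  least \<open>m\<close>, and that \<open>m\<close> itself comes from \<open>j = 0\<close>,
  available as soon as \<open>as\<close> is nonempty.\<close>

lemma partial_sums_Cons:
  "partial_sums (m # as) = {m + sum_list (take j as) | j. j < length as}"
proof (intro equalityI subsetI)
  fix x assume "x \<in> partial_sums (m # as)"
  then obtain j where j: "1 \<le> j" "j < Suc (length as)" "x = sum_list (take j (m # as))"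
    by (auto simp: partial_sums_def)
  then obtain i where "j = Suc i" by (cases j) auto
  with j show "x \<in> {m + sum_list (take j as) | j. j < length as}" by auto
next
  fix x assume "x \<in> {m + sum_list (take j as) | j. j < length as}"
  then obtain j where j: "j < length as" "x = m + sum_list (take j as)" by auto
  then show "x \<in> partial_sums (m # as)"
    unfolding partial_sums_def by (intro CollectI exI[of _ "Suc j"]) auto
qed

text \<open>Descents below \<open>m\<close> lie inside \<open>u\<close> and are never allowed; those
  above \<open>m\<close> are descents of \<open>v\<close> shifted by \<open>m\<close>; a descent at
  \<open>m\<close> itself is always allowed. Hence the condition left on \<open>v\<close> does not
  mention \<open>m\<close>, so it is the same for first blocks of length \<open>k\<close> and
  \<open>k + 1\<close>.\<close>

lemma descent_set_append_subset_partial_sums_iff: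
  assumes "length u = m" "length v = sum_list as"
  shows "descent_set (u @ v) \<subseteq> partial_sums (m # as) \<longleftrightarrow>
    sorted u \<and> (\<forall>i \<in> descent_set v. \<exists>j < length as. i = sum_list (take j as))"
    (is "?L \<longleftrightarrow> ?R")
proof
  assume L: ?L
  have "sorted u"
    unfolding sorted_iff_nth_Suc
  proof (intro allI impI)
    fix i assume i: "Suc i < length u"
    show "u ! i \<le> u ! Suc i"
    proof (rule ccontr)
      assume "\<not> ?thesis"
      then have "Suc i \<in> descent_set (u @ v)" using i by (auto simp: descent_set_def nth_append)
      with L i assms(1) show False by (auto simp: partial_sums_Cons)
    qed
  qed
  moreover have "\<exists>j < length as. i = sum_list (take j as)" if "i \<in> descent_set v" for i
  proof -
    have "m + i \<in> descent_set (u @ v)"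
      using that assms(1) by (auto simp: descent_set_def nth_append)
    with L have "m + i \<in> partial_sums (m # as)" by blast
    then show ?thesis by (auto simp: partial_sums_Cons)
  qed
  ultimately show ?R by blast
next
  assume R: ?R
  show ?L
  proof
    fix i assume i: "i \<in> descent_set (u @ v)"
    consider "i < m" | "i = m" | "i > m" by linarith
    then show "i \<in> partial_sums (m # as)"
    proof cases
      case 1
      have "u ! (i - 1) \<le> u ! i" using R 1 assms(1) by (intro sorted_nth_mono) auto
      moreover have "(u @ v) ! i < (u @ v) ! (i - 1)" using i by (simp add: descent_set_def)
      moreover have "i - 1 < m" using 1 by simp
      ultimately show ?thesis using 1 assms(1) by (simp add: nth_append)
    next
      case 2
      \<comment> \<open>With \<open>as\<close> empty, \<open>v\<close> would be empty too, and
        \<open>m\<close> would be the length of the word, which is no descent.\<close>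
      then have "as \<noteq> []" using i assms by (auto simp: descent_set_def)
      then show ?thesis using 2 by (auto simp: partial_sums_Cons intro!: exI[of _ 0])
    next
      case 3
      then have "i - m \<in> descent_set v"
        using i assms(1) by (auto simp: descent_set_def nth_append split: if_splits)
      then obtain j where "j < length as" "i - m = sum_list (take j as)" using R by blast
      then show ?thesis using 3 by (auto simp: partial_sums_Cons intro!: exI[of _ j])
    qed
  qed
qed

lemma append_in_ascending_perms_iff:
  assumes "length u = m" "length v = sum_list as"
  shows "u @ v \<in> ascending_perms (m # as) \<longleftrightarrow>
    distinct (u @ v) \<and> set (u @ v) = {1..m + sum_list as} \<and>
    sorted u \<and> (\<forall>i \<in> descent_set v. \<exists>j < length as. i = sum_list (take j as))"
  using descent_set_append_subset_partial_sums_iff[OF assms]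
  by (auto simp: ascending_perms_def permutations_of_set_def)

lemma ascending_perms_ConsE:
  assumes "w \<in> ascending_perms (m # as)"
  obtains u v where "w = u @ v" "length u = m" "length v = sum_list as"
proof -
  have "length w = m + sum_list as"
    using assms by (auto simp: ascending_perms_def dest: length_finite_permutations_of_set)
  then show ?thesis using that[of "take m w" "drop m w"] by simp
qed

lemma avoids_increasing_insert_max:
  assumes "length u = k" and max: "\<forall>x \<in> set v. x < N"
  shows "avoids_increasing (k + 2) (u @ N # v) \<longleftrightarrow> avoids_increasing (k + 2) (u @ v)"
proof -
  have "subseq (u @ v) (u @ N # v)"
    by (intro list_emb_append_mono list_emb_Cons subseq_order.order_refl)
  moreover have "subseq x (u @ v)"
    if x: "subseq x (u @ N # v)" "length x = k + 2" "sorted_wrt (<) x" for x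
  proof -
    obtain y z where yz: "x = y @ z" "subseq y u" "subseq z (N # v)"
      using x(1) by (auto simp: subseq_append_iff)
    have leny: "length y \<le> k" using yz(2) assms(1) list_emb_length by fastforce
    \<comment> \<open>Since \<open>u\<close> supplies at most \<open>k\<close> of the
      \<open>k + 2\<close> letters, \<open>z\<close> is nonempty, and only its first letter can use
      the inserted \<open>N\<close>.\<close>
    then obtain a z' where z: "z = a # z'" using x(2) yz(1) by (cases z) auto
    show ?thesis
    proof (cases "a = N")
      case True
      then have "subseq z' v" using yz(3) z by simp
      then have "\<forall>b \<in> set z'. b < N" using max by (blast elim: list_emb_set)
      moreover have "\<forall>b \<in> set z'. N < b" using x(3) yz(1) z True by (simp add: sorted_wrt_append)
      ultimately have "z' = []" by (cases z') auto
      \<comment> \<open>Here \<open>x\<close> would have at most \<open>k + 1\<close> letters, a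
        contradiction.\<close>
      then show ?thesis using x(2) yz(1) z leny by simp
    next
      case False
      then have "subseq z v" using yz(3) z by simp
      then show ?thesis using yz by (simp add: list_emb_append_mono)
    qed
  qed
  ultimately show ?thesis
    unfolding avoids_increasing_def using subseq_order.order_trans by blast
qed

text \<open>One equivalence serves both directions of the bijection: left to right for deleting the
  largest letter, right to left for inserting it.\<close>

lemma insert_largest_in_asc_avoiders_iff:
  assumes u: "length u = k" and v: "length v = sum_list as" and N: "N = k + 1 + sum_list as"
  shows "u @ N # v \<in> asc_avoiders (k + 2) ((k + 1) # as) \<longleftrightarrow>
    u @ v \<in> asc_avoiders (k + 2) (k # as)"
proof -
  have ins: "{1..N} = insert N {1..k + sum_list as}" "N \<notin> {1..k + sum_list as}"
    using N by auto
  have words: "distinct (u @ N # v) \<and> set (u @ N # v) = {1..N} \<longleftrightarrow>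
      distinct (u @ v) \<and> set (u @ v) = {1..k + sum_list as}"
  proof -
    have "distinct (u @ N # v) \<longleftrightarrow> distinct (u @ v) \<and> N \<notin> set (u @ v)" by auto
    moreover have "set (u @ N # v) = insert N (set (u @ v))" by simp
    \<comment> \<open>\<open>N\<close> is new to both sets, so it can be cancelled from the two
      insertions.\<close>
    ultimately show ?thesis using ins by (metis insert_ident)
  qed
  have "u @ N # v \<in> ascending_perms ((k + 1) # as) \<longleftrightarrow> u @ v \<in> ascending_perms (k # as)"
  proof -
    have "sorted (u @ [N]) \<longleftrightarrow> sorted u" if "set (u @ v) = {1..k + sum_list as}"
    proof -
      have "set u \<subseteq> {1..k + sum_list as}" using that by auto
      then have "\<forall>x \<in> set u. x \<le> N" using N by fastforce
      then show ?thesis by (simp add: sorted_append)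
    qed
    \<comment> \<open>The word is cut after \<open>N\<close>, so that \<open>u @ [N]\<close> is the
      first block and \<open>v\<close> is unchanged.\<close>
    moreover have "u @ N # v \<in> ascending_perms ((k + 1) # as) \<longleftrightarrow>
        (distinct (u @ N # v) \<and> set (u @ N # v) = {1..N}) \<and> sorted (u @ [N]) \<and>
        (\<forall>i \<in> descent_set v. \<exists>j < length as. i = sum_list (take j as))"
      using append_in_ascending_perms_iff[of "u @ [N]" "k + 1" v as] u v N
      by (simp only: append.assoc append.simps length_append list.size) simp
    ultimately show ?thesis
      unfolding words append_in_ascending_perms_iff[OF u v] by blast
  qed
  \<comment> \<open>Membership of \<open>u @ v\<close> bounds the letters of \<open>v\<close> below
    \<open>N\<close>.\<close>
  moreover have "avoids_increasing (k + 2) (u @ N # v) \<longleftrightarrow> avoids_increasing (k + 2) (u @ v)"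
    if "u @ v \<in> ascending_perms (k # as)"
  proof (rule avoids_increasing_insert_max[OF u])
    have "set (u @ v) = {1..k + sum_list as}"
      using that append_in_ascending_perms_iff[OF u v] by blast
    then have "set v \<subseteq> {1..k + sum_list as}" by auto
    then show "\<forall>x \<in> set v. x < N" using N by fastforce
  qed
  ultimately show ?thesis unfolding asc_avoiders_def by blast
qed

lemma asc_avoiders_largest_endsE:
  assumes "w \<in> asc_avoiders (k + 2) ((k + 1) # as)"
  obtains u v where "w = u @ (k + 1 + sum_list as) # v" "length u = k" "length v = sum_list as"
proof -
  let ?N = "k + 1 + sum_list as"
  have w: "w \<in> ascending_perms ((k + 1) # as)" "avoids_increasing (k + 2) w"
    using assms by (auto simp: asc_avoiders_def)
  obtain u' v where uv: "w = u' @ v" "length u' = k + 1" "length v = sum_list as"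
    using ascending_perms_ConsE[OF w(1)] .
  have p: "distinct (u' @ v)" "set (u' @ v) = {1..?N}" "sorted u'"
    using w(1) append_in_ascending_perms_iff[OF uv(2,3)] unfolding uv(1) by auto
  have inu: "?N \<in> set u'"
  proof (rule ccontr)
    assume n: "?N \<notin> set u'"
    have "?N \<in> set (u' @ v)" unfolding p(2) by simp
    with n have "subseq [?N] v" by (simp add: subseq_singleton_left)
    then have "subseq (u' @ [?N]) w" unfolding uv(1) by (simp add: list_emb_append_mono)
    moreover have "sorted_wrt (<) (u' @ [?N])"
    proof -
      have "x < ?N" if "x \<in> set u'" for x
      proof -
        have "x \<in> {1..?N}" using that p(2) by auto
        moreover have "x \<noteq> ?N" using that n by blast
        ultimately show ?thesis by simp
      qed
      then show ?thesis using p(1,3) by (simp add: sorted_wrt_append strict_sorted_iff)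
    qed
    ultimately show False using w(2) uv(2) by (auto simp: avoids_increasing_def)
  qed
  obtain u x where ux: "u' = u @ [x]" using uv(2) by (cases u' rule: rev_cases) auto
  have "x \<in> {1..?N}" using p(2) ux by auto
  \<comment> \<open>The last letter of the increasing block is at least its member
    \<open>?N\<close>, and no letter exceeds \<open>?N\<close>.\<close>
  then have "x = ?N" using inu p(3) unfolding ux by (auto simp: sorted_append)
  then show ?thesis using that[of u v] uv ux by simp
qed

text \<open>The letters are exactly those of \<open>{1..N}\<close>, so \<open>N\<close> is the
  maximum, and by distinctness \<open>remove1\<close> hits the displayed occurrence.\<close>

lemma delete_largest_insert:
  assumes "u @ N # v \<in> ascending_perms as" "N = sum_list as"
  shows "delete_largest (u @ N # v) = u @ v"
proof -
  have p: "distinct (u @ N # v)" "set (u @ N # v) = {1..N}"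
    using assms by (auto simp: ascending_perms_def permutations_of_set_def)
  have "Max (set (u @ N # v)) = N"
    by (rule Max_eqI) (use p(2) in \<open>simp_all add: set_eq_iff\<close>)
  then show ?thesis using p(1) by (simp add: delete_largest_def remove1_append)
qed

theorem lemma1p6:
  fixes k :: nat and as :: "nat list"
  assumes "k \<ge> 1"
  shows "card (asc_avoiders (k + 2) ((k + 1) # as)) = card (asc_avoiders (k + 2) (k # as))
    \<and> bij_betw delete_largest
         (asc_avoiders (k + 2) ((k + 1) # as)) (asc_avoiders (k + 2) (k # as))"
proof -
  let ?A = "asc_avoiders (k + 2) ((k + 1) # as)" and ?B = "asc_avoiders (k + 2) (k # as)"
  define N where "N = k + 1 + sum_list as"
  \<comment> \<open>The explicit inverse: cutting after \<open>k\<close> letters puts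
    \<open>N\<close> at the end of the first block, which then has length
    \<open>k + 1\<close>.\<close>
  let ?ins = "\<lambda>w. take k w @ N # drop k w"
  have del: "delete_largest (u @ N # v) = u @ v" if "u @ N # v \<in> ?A" for u v
    using that by (intro delete_largest_insert[of _ _ _ "(k + 1) # as"])
      (auto simp: asc_avoiders_def N_def)
  have A: "delete_largest w \<in> ?B \<and> ?ins (delete_largest w) = w" if w: "w \<in> ?A" for w
  proof -
    obtain u v where uv: "w = u @ N # v" "length u = k" "length v = sum_list as"
      using asc_avoiders_largest_endsE[OF w] unfolding N_def .
    have "delete_largest w = u @ v" using del w unfolding uv(1) by blast
    then show ?thesis using insert_largest_in_asc_avoiders_iff[OF uv(2,3) N_def] w uv by simp
  qed
  have B: "?ins w \<in> ?A \<and> delete_largest (?ins w) = w" if w: "w \<in> ?B" for w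
  proof -
    obtain u v where uv: "w = u @ v" "length u = k" "length v = sum_list as"
      using ascending_perms_ConsE w unfolding asc_avoiders_def by blast
    have "u @ N # v \<in> ?A"
      using insert_largest_in_asc_avoiders_iff[OF uv(2,3) N_def] w uv by blast
    then show ?thesis using del uv by simp
  qed
  have "bij_betw delete_largest ?A ?B"
    by (rule bij_betw_byWitness[where f' = ?ins]) (use A B in blast)+
  then show ?thesis using bij_betw_same_card by blast
qed

end
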